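(* Let $b,\rho\in\mathbb{C}$ with $\operatorname{Re}(\rho)>0$ and let $z\in\mathbb{C}\setminus(-\infty,0]$. (i) For $\nu,c\in\mathbb{C}$ with $\operatorname{Re}(\nu)>-\tfrac32$, $\operatorname{Re}(c)>\tfrac12$, writing $g_{\pm}(z)=g_{\nu\pm1}^{(b,c-1)}(z;\rho)$, $$z^2\Big[\frac{\partial^2}{\partial z^2}g_-+b\,\frac{\partial^2}{\partial z^2}g_+\Big]+z\Big[\big(\tfrac52-\nu\big)\frac{\partial}{\partial z}g_-+b\big(\nu+\tfrac72\big)\frac{\partial}{\partial z}g_+\Big]=-\frac{1-\nu}2\,g_--b\,\frac{2+\nu}2\,g_+ .$$ (ii) For $\nu,\lambda\in\mathbb{C}$ with $\operatorname{Re}(\nu)>-1$, $\operatorname{Re}(\lambda)>0$, writing $C_\pm(z)=C_{\nu\pm1}^{(b,\lambda-1)}(z;\rho)$, $$-b(3\nu+5)z\frac{\partial}{\partial z}C_+-b(\nu+1)^2C_+-2bz^2\frac{\partial^2}{\partial z^2}C_+=(\nu+1)\frac{\partial}{\partial z}C_-+2z\frac{\partial^2}{\partial z^2}C_- .$$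
   Context: For $\rho\in\mathbb{C}$ with $\operatorname{Re}(\rho)>0$ and $x\in\mathbb{C}$ put $\Gamma_\rho(x)=\int_0^\infty t^{x-1}e^{-t-\rho/t}\,dt$. The generalized Pochhammer symbol is $(\lambda;\rho)_\nu:=\Gamma_\rho(\lambda+\nu)/\Gamma(\lambda)$ for $\lambda,\nu\in\mathbb{C}$, where $1/\Gamma$ is read as an entire function (zero at $0,-1,-2,\dots$). The unified four parameter Bessel function is $G_\nu^{(b,c)}(z;\rho):=\sum_{k=0}^\infty \frac{(-b)^k (c;\rho)_{2k+\nu}}{\Gamma(\nu+k+1)\,\Gamma(\nu+2k+1)}\,\frac{(z/2)^{2k+\nu}}{k!}$. The generalized four parameter spherical Bessel and Bessel-Clifford functions are $$g_\nu^{(b,c)}(z;\rho):=\sqrt{\tfrac{\pi}{2z}}\,G_{\nu+\frac12}^{(b,c-\frac12)}(z;\rho)=\frac{\sqrt\pi}{2}\sum_{k=0}^\infty\frac{(-b)^k(c-\frac12;\rho)_{2k+\nu+\frac12}}{k!\,\Gamma(\nu+k+\frac32)\,\Gamma(\nu+2k+\frac32)}\Big(\frac z2\Big)^{2k+\nu},$$ $$C_\nu^{(b,\lambda)}(z;\rho):=z^{-\nu/2}G_\nu^{(b,\lambda)}(2\sqrt z;\rho)=\sum_{k=0}^\infty\frac{(-b)^k(\lambda;\rho)_{2k+\nu}}{k!\,\Gamma(\nu+k+1)\,\Gamma(\nu+2k+1)}\,z^k.$$ Functions with shifted parameters (including order $\nu-1$) are given by the same series. Powers and square roots are principal. *)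

theory Defs
  imports "HOL-Complex_Analysis.Complex_Analysis"
begin

text \<open>The integral converges absolutely for every \<open>x\<close> as soon as \<open>Re \<rho> > 0\<close>.\<close>

definition Gamma_ext :: "complex \<Rightarrow> complex \<Rightarrow> complex" where
  "Gamma_ext \<rho> x =
     integral {0<..} (\<lambda>t::real. of_real t powr (x - 1) * exp (- of_real t - \<rho> / of_real t))"

text \<open>The symbol \<open>(\<lambda>;\<rho>)\<^sub>\<nu>\<close>. Here and below every \<open>1/\<Gamma>\<close> is the entire function \<open>rGamma\<close>.\<close>

definition pochhammer_ext :: "complex \<Rightarrow> complex \<Rightarrow> complex \<Rightarrow> complex" where
  "pochhammer_ext lam \<rho> \<nu> = Gamma_ext \<rho> (lam + \<nu>) * rGamma lam"

text \<open>The arguments are ordered so that partial application gives a function of \<open>z\<close>: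
  \<open>unified_Bessel b c \<nu> \<rho> z\<close> is \<open>G\<^sub>\<nu>(z;\<rho>)\<close> with upper parameters \<open>(b,c)\<close>.\<close>

definition unified_Bessel ::
  "complex \<Rightarrow> complex \<Rightarrow> complex \<Rightarrow> complex \<Rightarrow> complex \<Rightarrow> complex" where
  "unified_Bessel b c \<nu> \<rho> z =
     (\<Sum>k. (- b) ^ k * pochhammer_ext c \<rho> (2 * of_nat k + \<nu>)
            * rGamma (\<nu> + of_nat k + 1) * rGamma (\<nu> + 2 * of_nat k + 1)
            * ((z / 2) powr (2 * of_nat k + \<nu>) / fact k))"

definition spherical_Bessel ::
  "complex \<Rightarrow> complex \<Rightarrow> complex \<Rightarrow> complex \<Rightarrow> complex \<Rightarrow> complex" where
  "spherical_Bessel b c \<nu> \<rho> z =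
     csqrt (of_real pi / (2 * z)) * unified_Bessel b (c - 1/2) (\<nu> + 1/2) \<rho> z"

definition Bessel_Clifford ::
  "complex \<Rightarrow> complex \<Rightarrow> complex \<Rightarrow> complex \<Rightarrow> complex \<Rightarrow> complex" where
  "Bessel_Clifford b lam \<nu> \<rho> z =
     z powr (- \<nu> / 2) * unified_Bessel b lam \<nu> \<rho> (2 * csqrt z)"

end

theory Submission
  imports Defs
begin

text \<open>
  All three functions are built from one entire function. Dividing
  \<open>G\<^sub>\<nu>(z;\<rho>)\<close> by \<open>(z/2)\<^sup>\<nu>\<close> leaves a power series \<open>\<Phi>\<^sub>\<nu>\<close> in \<open>w = z\<^sup>2/4\<close>, whose
  coefficients decay like \<open>1/(k!)\<^sup>2\<close>, up to a geometric factor at most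
  (\<open>summable_clifford_coeff\<close>). The Bessel-Clifford function of order \<open>\<nu>\<close> is \<open>\<Phi>\<^sub>\<nu>\<close> itself, and
  the spherical function of order \<open>\<nu>\<close> is \<open>(\<surd>\<pi>/2) (z/2)\<^sup>\<nu> \<Phi>(z\<^sup>2/4)\<close> with \<open>\<Phi>\<close> of order
  \<open>\<nu> + 1/2\<close> and upper parameter \<open>c - 1/2\<close>.

  The index of the Pochhammer symbol in the \<open>k\<close>-th coefficient is \<open>2k + \<nu>\<close>, so its value in
  \<open>\<Phi>\<^bsub>\<mu>+1\<^esub>\<close> at \<open>k\<close> is the one in \<open>\<Phi>\<^bsub>\<mu>-1\<^esub>\<close> at \<open>k + 1\<close>, and the same holds for the factor
  \<open>1/\<Gamma>(\<mu> + 2k + 2)\<close>. The two coefficients therefore differ only by \<open>-b/(k + 1)\<close> and by one step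
  of the remaining Gamma factor, whatever the values of the integral \<open>\<Gamma>\<^sub>\<rho>\<close> may be. In terms of
  functions this is the first-order relation
  \<open>\<Phi>\<^bsub>\<mu>-1\<^esub>' = -b (\<mu> + 1 + w d/dw) \<Phi>\<^bsub>\<mu>+1\<^esub>\<close>. Applying \<open>\<mu> + 1 + 2 w d/dw\<close>, which multiplies the
  \<open>k\<close>-th coefficient by \<open>\<mu> + 1 + 2k\<close> (\<open>clifford_coeff_adjacent\<close>), gives the second-order
  relation \<open>clifford_powser_adjacent\<close>. This is the Bessel-Clifford identity; the spherical
  identity is its pullback under \<open>w = z\<^sup>2/4\<close> with \<open>\<mu> = \<nu> + 1/2\<close>, multiplied by a power of \<open>z\<close>.
\<close>

section \<open>Growth of the extended Gamma integral\<close>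

text \<open>For \<open>t > 0\<close> the factor \<open>exp (- \<rho> / t)\<close> has modulus at most one, which leaves Euler's
  integral. This bound is sharp enough for the growth of the series coefficients.\<close>

lemma norm_Gamma_ext_le:
  assumes "Re \<rho> > 0" and "Re x > 0"
  shows "norm (Gamma_ext \<rho> x) \<le> Gamma (Re x)"
proof -
  let ?f = "\<lambda>t::real. of_real t powr (x - 1) * exp (- of_real t - \<rho> / of_real t) :: complex"
  let ?g = "\<lambda>t::real. t powr (Re x - 1) / exp t"
  have "(?g has_integral Gamma (Re x)) {0..}"
    using assms by (intro Gamma_integral_real) auto
  hence g: "(?g has_integral Gamma (Re x)) {0<..}"
    by (rule has_integral_spike_set_eq[THEN iffD1, rotated 2])
       (auto intro!: negligible_subset[OF negligible_sing[of "0::real"]])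
  have le: "norm (?f t) \<le> ?g t" if "t \<in> {0<..}" for t
  proof -
    from that have t: "t > 0" by simp
    have "norm (?f t) = t powr (Re x - 1) * exp (- t - Re \<rho> / t)"
      using t by (simp add: norm_mult norm_powr_real_powr)
    also have "\<dots> \<le> t powr (Re x - 1) * exp (- t)"
      using t assms by (intro mult_left_mono) auto
    finally show ?thesis by (simp add: exp_minus field_simps)
  qed
  show ?thesis
  proof (cases "?f integrable_on {0<..}")
    case True
    have "norm (integral {0<..} ?f) \<le> integral {0<..} ?g"
      by (rule Henstock_Kurzweil_Integration.integral_norm_bound_integral[OF True _ le]) (use g in auto)
    with g show ?thesis by (simp add: Gamma_ext_def integral_unique)
  next
    case False
    \<comment> \<open>Here the integral would take its default value \<open>0\<close>, which satisfies the bound.\<close>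
    with assms show ?thesis
      by (simp add: Gamma_ext_def not_integrable_integral Gamma_real_nonneg)
  qed
qed

section \<open>The power series behind the three functions\<close>

text \<open>The Taylor coefficients of the Bessel-Clifford function, that is, of \<open>G\<^sub>\<nu>\<close> with the factor
  \<open>(z/2)\<^sup>\<nu>\<close> removed, in the variable \<open>z\<^sup>2/4\<close>.\<close>

definition clifford_coeff ::
  "complex \<Rightarrow> complex \<Rightarrow> complex \<Rightarrow> complex \<Rightarrow> nat \<Rightarrow> complex" where
  "clifford_coeff b c \<nu> \<rho> k =
     (- b) ^ k * pochhammer_ext c \<rho> (2 * of_nat k + \<nu>)
       * rGamma (\<nu> + of_nat k + 1) * rGamma (\<nu> + 2 * of_nat k + 1) / fact k"

definition powser :: "(nat \<Rightarrow> complex) \<Rightarrow> complex \<Rightarrow> complex" where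
  "powser a w = (\<Sum>k. a k * w ^ k)"

text \<open>Passing from \<open>k\<close> to \<open>k + 1\<close> moves both \<open>Gamma (2k + \<sigma>)\<close> and \<open>rGamma (\<nu> + 2k + 1)\<close> by
  two steps. The resulting quadratic factors cancel up to a constant, the other \<open>rGamma\<close> does not
  grow, and the factorial forces the quotient of consecutive terms to zero. The term
  \<open>Gamma (2k + \<sigma>)\<close> majorizes the Pochhammer symbol, up to the constant
  \<open>rGamma c\<close>, when \<open>\<sigma> = Re (c + \<nu>)\<close>.\<close>

lemma summable_clifford_majorant:
  fixes \<nu> :: complex and \<sigma> R :: real
  assumes "R \<ge> 0"
  shows "summable (\<lambda>k. R ^ k * Gamma (2 * real k + \<sigma>) * norm (rGamma (\<nu> + of_nat k + 1))
                        * norm (rGamma (\<nu> + 2 * of_nat k + 1)) / fact k)"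
    (is "summable ?M")
proof -
  \<comment> \<open>From this index on, the shifts \<open>\<sigma>\<close> and \<open>\<nu>\<close> cost at most a factor \<open>2\<close> in each of
     the two Gamma steps, and \<open>R / (k + 1) \<le> 1/8\<close> turns the resulting \<open>4\<close> into a ratio \<open>1/2\<close>.\<close>
  define N where "N = nat \<lceil>2 + \<bar>\<sigma>\<bar> + norm \<nu> + 8 * R\<rceil>"
  show ?thesis
  proof (rule summable_ratio_test)
    show "(1/2 :: real) < 1" by simp
  next
    fix k assume "k \<ge> N"
    hence k: "real k \<ge> 2 + \<bar>\<sigma>\<bar> + norm \<nu> + 8 * R" unfolding N_def by linarith
    define u where "u = norm (rGamma (\<nu> + of_nat k + 1))"
    define u' where "u' = norm (rGamma (\<nu> + of_nat (Suc k) + 1))"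
    define v where "v = norm (rGamma (\<nu> + 2 * of_nat k + 1))"
    define v' where "v' = norm (rGamma (\<nu> + 2 * of_nat (Suc k) + 1))"
    define G where "G = Gamma (2 * real k + \<sigma>)"
    define G' where "G' = Gamma (2 * real (Suc k) + \<sigma>)"
    have nn: "u \<ge> 0" "u' \<ge> 0" "v \<ge> 0" "v' \<ge> 0" by (simp_all add: u_def u'_def v_def v'_def)
    have pos: "2 * real k + \<sigma> > 0" using k assms norm_ge_zero[of \<nu>] by linarith
    have G0: "G \<ge> 0" unfolding G_def using pos by (intro Gamma_real_nonneg) auto
    have G': "G' = (2 * real k + \<sigma> + 1) * (2 * real k + \<sigma>) * G"
    proof -
      have "Gamma (2 * real k + \<sigma> + 1 + 1) = (2 * real k + \<sigma> + 1) * Gamma (2 * real k + \<sigma> + 1)"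
        by (rule Gamma_plus1) (use pos in \<open>auto elim!: nonpos_Ints_cases\<close>)
      also have "Gamma (2 * real k + \<sigma> + 1) = (2 * real k + \<sigma>) * Gamma (2 * real k + \<sigma>)"
        by (rule Gamma_plus1) (use pos in \<open>auto elim!: nonpos_Ints_cases\<close>)
      finally show ?thesis by (simp add: G'_def G_def algebra_simps)
    qed
    have lower: "norm (\<nu> + of_real r) \<ge> r - norm \<nu>" for r :: real
      using norm_triangle_ineq2[of "of_real r" "- \<nu>"] by (simp add: add.commute)
    have u: "u' \<le> u"
    proof -
      have "u = norm (\<nu> + of_real (real k + 1)) * u'"
        using rGamma_plus1[of "\<nu> + of_nat k + 1"]
        by (simp add: u_def u'_def norm_mult[symmetric] add_ac)
      moreover have "norm (\<nu> + of_real (real k + 1)) \<ge> 1"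
        using lower[of "real k + 1"] k assms by linarith
      ultimately show ?thesis using nn(2) mult_right_mono[of 1 _ u'] by simp
    qed
    define p where "p = norm (\<nu> + of_real (2 * real k + 1))"
    define q where "q = norm (\<nu> + of_real (2 * real k + 2))"
    have v: "v = p * q * v'"
    proof -
      have "rGamma (\<nu> + 2 * of_nat k + 1) =
              (\<nu> + 2 * of_nat k + 1) * ((\<nu> + 2 * of_nat k + 2) * rGamma (\<nu> + 2 * of_nat (Suc k) + 1))"
        using rGamma_plus1[of "\<nu> + 2 * of_nat k + 1"] rGamma_plus1[of "\<nu> + 2 * of_nat k + 2"]
        by (simp add: algebra_simps)
      thus ?thesis by (simp add: v_def v'_def p_def q_def norm_mult add_ac)
    qed
    have p: "2 * p \<ge> 2 * real k + \<sigma>" and q: "2 * q \<ge> 2 * real k + \<sigma> + 1"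
      using lower[of "2 * real k + 1"] lower[of "2 * real k + 2"] k assms
      unfolding p_def q_def by linarith+
    have Gv: "G' * v' \<le> 4 * (G * v)"
    proof -
      have "(2 * real k + \<sigma> + 1) * (2 * real k + \<sigma>) \<le> (2 * q) * (2 * p)"
        using p q pos by (intro mult_mono) auto
      hence "((2 * real k + \<sigma> + 1) * (2 * real k + \<sigma>)) * (G * v') \<le> ((2 * q) * (2 * p)) * (G * v')"
        using G0 nn by (intro mult_right_mono) auto
      thus ?thesis by (simp add: G' v algebra_simps)
    qed
    have "8 * R \<le> real k + 1" using k assms norm_ge_zero[of \<nu>] by linarith
    hence R: "R / real (Suc k) \<le> 1 / 8" by (simp add: field_simps)
    have G'0: "G' \<ge> 0" using G' G0 pos by simp
    have "?M (Suc k) = R ^ Suc k * G' * u' * v' / fact (Suc k)"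
      by (simp only: u'_def v'_def G'_def)
    also have "\<dots> = R ^ k / fact k * (R / real (Suc k)) * ((G' * v') * u')"
      by (simp add: field_simps)
    finally have "norm (?M (Suc k)) = R ^ k / fact k * (R / real (Suc k)) * ((G' * v') * u')"
      using nn assms G'0 by simp
    also have "\<dots> \<le> R ^ k / fact k * (1 / 8) * ((4 * (G * v)) * u)"
    proof (rule mult_mono)
      show "R ^ k / fact k * (R / real (Suc k)) \<le> R ^ k / fact k * (1 / 8)"
        using R assms by (intro mult_left_mono) auto
      show "(G' * v') * u' \<le> (4 * (G * v)) * u"
        by (rule mult_mono[OF Gv u]) (use nn G0 in auto)
    qed (use nn assms G'0 in auto)
    also have "\<dots> = 1/2 * norm (?M k)"
      using nn assms G0 by (simp add: u_def v_def G_def[symmetric] abs_mult)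
    finally show "norm (?M (Suc k)) \<le> 1/2 * norm (?M k)" .
  qed
qed

lemma summable_clifford_coeff:
  assumes "Re \<rho> > 0"
  shows "summable (\<lambda>k. clifford_coeff b c \<nu> \<rho> k * w ^ k)"
proof -
  define \<sigma> where "\<sigma> = Re (c + \<nu>)"
  let ?M = "\<lambda>k. (norm b * norm w) ^ k * Gamma (2 * real k + \<sigma>) * norm (rGamma (\<nu> + of_nat k + 1))
                  * norm (rGamma (\<nu> + 2 * of_nat k + 1)) / fact k"
  show ?thesis
  proof (rule summable_comparison_test')
    show "summable (\<lambda>k. norm (rGamma c) * ?M k)"
      by (intro summable_mult summable_clifford_majorant) simp
  next
    fix k assume k: "k \<ge> nat \<lceil>1 + \<bar>\<sigma>\<bar>\<rceil>"
    have "norm (Gamma_ext \<rho> (c + (2 * of_nat k + \<nu>))) \<le> Gamma (Re (c + (2 * of_nat k + \<nu>)))"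
    proof (rule norm_Gamma_ext_le[OF assms])
      have "2 * real k + \<sigma> > 0" using k by linarith
      thus "Re (c + (2 * of_nat k + \<nu>)) > 0" by (simp add: \<sigma>_def)
    qed
    also have "Re (c + (2 * of_nat k + \<nu>)) = 2 * real k + \<sigma>" by (simp add: \<sigma>_def)
    finally have G: "norm (Gamma_ext \<rho> (c + (2 * of_nat k + \<nu>))) \<le> Gamma (2 * real k + \<sigma>)" .
    have "norm (clifford_coeff b c \<nu> \<rho> k * w ^ k) =
            norm (Gamma_ext \<rho> (c + (2 * of_nat k + \<nu>))) *
            ((norm b * norm w) ^ k * norm (rGamma c) * norm (rGamma (\<nu> + of_nat k + 1))
              * norm (rGamma (\<nu> + 2 * of_nat k + 1)) / fact k)"
      by (simp add: clifford_coeff_def pochhammer_ext_def norm_mult norm_divide norm_power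
            power_mult_distrib mult_ac)
    also have "\<dots> \<le> Gamma (2 * real k + \<sigma>) *
            ((norm b * norm w) ^ k * norm (rGamma c) * norm (rGamma (\<nu> + of_nat k + 1))
              * norm (rGamma (\<nu> + 2 * of_nat k + 1)) / fact k)"
      by (intro mult_right_mono G) auto
    finally show "norm (clifford_coeff b c \<nu> \<rho> k * w ^ k) \<le> norm (rGamma c) * ?M k"
      by (simp add: mult_ac)
  qed
qed

lemma unified_Bessel_eq_powser:
  assumes "Re \<rho> > 0" and "z \<noteq> 0"
  shows "unified_Bessel b c \<nu> \<rho> z = (z / 2) powr \<nu> * powser (clifford_coeff b c \<nu> \<rho>) (z\<^sup>2 / 4)"
proof -
  have pw: "(z / 2) powr (2 * of_nat k + \<nu>) = (z / 2) powr \<nu> * (z\<^sup>2 / 4) ^ k" for k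
  proof -
    have "(z / 2) powr (of_nat (2 * k) + \<nu>) = (z / 2) ^ (2 * k) * (z / 2) powr \<nu>"
      using assms powr_complexpow[of "z / 2" "2 * k"] by (simp add: powr_add del: of_nat_mult powr_complexpow)
    moreover have "(z / 2) ^ (2 * k) = (z\<^sup>2 / 4) ^ k"
      by (simp only: power_mult power_divide) simp
    ultimately show ?thesis by (simp add: mult.commute)
  qed
  have "unified_Bessel b c \<nu> \<rho> z =
          (\<Sum>k. (z / 2) powr \<nu> * (clifford_coeff b c \<nu> \<rho> k * (z\<^sup>2 / 4) ^ k))"
    unfolding unified_Bessel_def clifford_coeff_def
    by (intro suminf_cong) (simp only: pw, simp add: mult_ac)
  thus ?thesis
    by (simp add: powser_def suminf_mult summable_clifford_coeff[OF assms(1)])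
qed

text \<open>The principal square root halves \<open>Ln\<close>, so \<open>z powr (- \<nu> / 2)\<close> cancels \<open>csqrt z powr \<nu>\<close> on both
  sides of the branch cut and on the cut itself.\<close>

lemma Bessel_Clifford_eq_powser:
  assumes "Re \<rho> > 0" and "z \<noteq> 0"
  shows "Bessel_Clifford b c \<nu> \<rho> z = powser (clifford_coeff b c \<nu> \<rho>) z"
proof -
  have "csqrt z powr \<nu> = z powr (\<nu> / 2)"
  proof -
    have "Ln (csqrt z) = Ln z / 2"
      unfolding csqrt_exp_Ln[OF assms(2)]
      using mpi_less_Im_Ln[OF assms(2)] Im_Ln_le_pi[OF assms(2)] pi_gt_zero
      by (intro Ln_exp; simp; linarith)
    hence "\<nu> * Ln (csqrt z) = \<nu> / 2 * Ln z" by simp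
    thus ?thesis using assms by (simp only: powr_def csqrt_eq_0 if_False)
  qed
  thus ?thesis
    using assms
    by (simp add: Bessel_Clifford_def unified_Bessel_eq_powser power_mult_distrib
          powr_add[symmetric] flip: mult.assoc)
qed

text \<open>On the slit plane \<open>Ln\<close> of a reciprocal is minus \<open>Ln\<close>, so the prefactor
  \<open>csqrt (\<pi> / (2z))\<close> equals \<open>(\<surd>\<pi>/2) (z/2) powr (-1/2)\<close> for the principal branches and lowers the
  exponent \<open>\<nu> + 1/2\<close> to \<open>\<nu>\<close>.\<close>

lemma spherical_Bessel_eq_powser:
  assumes "Re \<rho> > 0" and z: "z \<notin> \<real>\<^sub>\<le>\<^sub>0"
  shows "spherical_Bessel b c \<nu> \<rho> z =
           of_real (sqrt pi / 2) * (z / 2) powr \<nu>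
             * powser (clifford_coeff b (c - 1/2) (\<nu> + 1/2) \<rho>) (z\<^sup>2 / 4)"
proof -
  have z0: "z \<noteq> 0" and z2: "z / 2 \<notin> \<real>\<^sub>\<le>\<^sub>0"
    using z by (auto simp: complex_nonpos_Reals_iff)
  have "of_real pi / (2 * z) = of_real (pi / 4) * inverse (z / 2)"
    using z0 by (simp add: field_simps)
  hence "csqrt (of_real pi / (2 * z)) = (of_real (pi / 4) * inverse (z / 2)) powr (1/2)"
    by (simp only: csqrt_conv_powr)
  also have "\<dots> = exp ((Ln (of_real (pi / 4) * inverse (z / 2))) / 2)"
    using z0 by (simp add: powr_def)
  also have "Ln (of_real (pi / 4) * inverse (z / 2)) = of_real (ln (pi / 4)) - Ln (z / 2)"
    using z0 Ln_inverse[OF z2] Ln_of_real[of "pi / 4"]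
    by (subst Ln_times_of_real) (simp_all del: inverse_divide of_real_divide)
  also have "exp ((of_real (ln (pi / 4)) - Ln (z / 2)) / 2)
      = of_real (exp (ln (pi / 4) / 2)) * (z / 2) powr (- 1/2)"
  proof -
    have "(of_real (ln (pi / 4)) - Ln (z / 2)) / 2
            = of_real (ln (pi / 4) / 2) + (- 1/2) * Ln (z / 2)"
      by (simp add: diff_divide_distrib)
    thus ?thesis using z0 by (simp only: exp_add exp_of_real) (simp add: powr_def)
  qed
  also have "exp (ln (pi / 4) / 2) = sqrt pi / 2"
    using powr_half_sqrt[of "pi / 4"] by (simp add: powr_def real_sqrt_divide)
  finally have sq: "csqrt (of_real pi / (2 * z)) = of_real (sqrt pi / 2) * (z / 2) powr (- 1/2)" .
  have "(z / 2) powr (- 1/2) * (z / 2) powr (\<nu> + 1/2) = (z / 2) powr \<nu>"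
    by (simp flip: powr_add)
  thus ?thesis
    unfolding spherical_Bessel_def sq unified_Bessel_eq_powser[OF assms(1) z0]
    by (simp add: mult.assoc)
qed

section \<open>The differential relation between adjacent orders\<close>

lemma powser_has_field_derivative:
  assumes "\<And>w. summable (\<lambda>k. a k * w ^ k)"
  shows "(powser a has_field_derivative powser (diffs a) w) (at w)"
  using termdiffs_strong_converges_everywhere[OF assms]
  unfolding powser_def[abs_def] .

text \<open>The monomials \<open>w\<^sup>k\<close> are eigenvectors of \<open>w d/dw\<close> and of \<open>w\<^sup>2 d\<^sup>2/dw\<^sup>2\<close>. In this form the
  differentiated series keep the exponent \<open>k\<close>, so differential relations can be read off
  from the coefficients.\<close>

lemma powser_Euler_sums:
  assumes "\<And>w. summable (\<lambda>k. a k * w ^ k)"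
  shows "(\<lambda>k. of_nat k * a k * w ^ k) sums (w * powser (diffs a) w)"
proof -
  have "(\<lambda>k. w * (of_nat k * a k * w ^ (k - Suc 0))) sums (w * powser (diffs a) w)"
    unfolding powser_def
    by (intro sums_mult diffs_equiv termdiff_converges_all assms)
  also have "(\<lambda>k. w * (of_nat k * a k * w ^ (k - Suc 0))) = (\<lambda>k. of_nat k * a k * w ^ k)"
  proof
    fix k show "w * (of_nat k * a k * w ^ (k - Suc 0)) = of_nat k * a k * w ^ k"
      by (cases k) auto
  qed
  finally show ?thesis .
qed

lemma powser_Euler2_sums:
  assumes "\<And>w. summable (\<lambda>k. a k * w ^ k)"
  shows "(\<lambda>k. of_nat k * (of_nat k - 1) * a k * w ^ k) sums (w\<^sup>2 * powser (diffs (diffs a)) w)"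
proof -
  have "(\<lambda>k. of_nat k * diffs a k * w ^ k) sums (w * powser (diffs (diffs a)) w)"
    by (intro powser_Euler_sums termdiff_converges_all assms)
  hence "(\<lambda>k. w * (of_nat k * diffs a k * w ^ k)) sums (w\<^sup>2 * powser (diffs (diffs a)) w)"
    using sums_mult[of _ _ w] by (simp add: power2_eq_square mult.assoc)
  hence "(\<lambda>k. of_nat (Suc k) * (of_nat (Suc k) - 1) * a (Suc k) * w ^ Suc k)
           sums (w\<^sup>2 * powser (diffs (diffs a)) w)"
    by (simp add: diffs_def mult_ac)
  thus ?thesis by (subst (asm) sums_Suc_iff) simp
qed

text \<open>The Pochhammer symbol has index \<open>2k + \<mu> + 1\<close> on both sides, and the factor
  \<open>rGamma (\<mu> + 2k + 2)\<close> is also common. What remains is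
  \<open>rGamma (\<mu> + k + 1) = (\<mu> + k + 1) rGamma (\<mu> + k + 2)\<close>, which holds at the poles of
  \<open>\<Gamma>\<close> too. The common factor \<open>\<mu> + 1 + 2k\<close> is the eigenvalue of \<open>\<mu> + 1 + 2 w d/dw\<close> on \<open>w\<^sup>k\<close>.\<close>

lemma clifford_coeff_adjacent:
  "(of_nat k + 1) * (\<mu> + 1 + 2 * of_nat k) * clifford_coeff b c (\<mu> - 1) \<rho> (Suc k) =
     - b * ((\<mu> + 1 + 2 * of_nat k) * (\<mu> + 1 + of_nat k)) * clifford_coeff b c (\<mu> + 1) \<rho> k"
proof -
  define A where "A = pochhammer_ext c \<rho> (2 * of_nat k + \<mu> + 1)"
  define r where "r = rGamma (\<mu> + 2 * of_nat k + 2)"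
  have "clifford_coeff b c (\<mu> - 1) \<rho> (Suc k) =
          (- b) ^ Suc k * A * rGamma (\<mu> + of_nat k + 1) * r / fact (Suc k)"
    by (simp add: clifford_coeff_def A_def r_def algebra_simps)
  hence lower: "(of_nat k + 1) * clifford_coeff b c (\<mu> - 1) \<rho> (Suc k) =
          - b * ((- b) ^ k * A * rGamma (\<mu> + of_nat k + 1) * r / fact k)"
    by (simp add: divide_simps del: of_nat_Suc) (simp add: mult_ac add_ac)
  have upper: "clifford_coeff b c (\<mu> + 1) \<rho> k =
          (- b) ^ k * A * rGamma (\<mu> + of_nat k + 2) * r / fact k"
    by (simp add: clifford_coeff_def A_def r_def algebra_simps)
  have step: "rGamma (\<mu> + of_nat k + 1) = (\<mu> + 1 + of_nat k) * rGamma (\<mu> + of_nat k + 2)"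
    using rGamma_plus1[of "\<mu> + of_nat k + 1"] by (simp add: algebra_simps)
  have "(of_nat k + 1) * (\<mu> + 1 + 2 * of_nat k) * clifford_coeff b c (\<mu> - 1) \<rho> (Suc k) =
          (\<mu> + 1 + 2 * of_nat k) * ((of_nat k + 1) * clifford_coeff b c (\<mu> - 1) \<rho> (Suc k))"
    by (simp only: mult_ac)
  also have "\<dots> = - b * ((\<mu> + 1 + 2 * of_nat k) * (\<mu> + 1 + of_nat k)) * clifford_coeff b c (\<mu> + 1) \<rho> k"
    unfolding lower upper step by (simp add: mult_ac)
  finally show ?thesis .
qed

text \<open>Expanding \<open>(\<mu> + 1 + 2k) (\<mu> + 1 + k)\<close> as
  \<open>2k(k - 1) + (3\<mu> + 5)k + (\<mu> + 1)\<^sup>2\<close> turns the relation between coefficients into one between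
  Euler operators.\<close>

lemma clifford_powser_adjacent:
  fixes \<mu> b c \<rho> w :: complex
  defines "m \<equiv> clifford_coeff b c (\<mu> - 1) \<rho>" and "p \<equiv> clifford_coeff b c (\<mu> + 1) \<rho>"
  assumes "Re \<rho> > 0"
  shows "- b * (3 * \<mu> + 5) * w * powser (diffs p) w - b * (\<mu> + 1)\<^sup>2 * powser p w
           - 2 * b * w\<^sup>2 * powser (diffs (diffs p)) w
         = (\<mu> + 1) * powser (diffs m) w + 2 * w * powser (diffs (diffs m)) w"
proof -
  have sm: "summable (\<lambda>k. m k * x ^ k)" and sp: "summable (\<lambda>k. p k * x ^ k)" for x
    unfolding m_def p_def by (rule summable_clifford_coeff[OF assms(3)])+
  have lower: "(\<lambda>k. (\<mu> + 1) * (diffs m k * w ^ k) + 2 * (of_nat k * diffs m k * w ^ k)) sums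
          ((\<mu> + 1) * powser (diffs m) w + 2 * (w * powser (diffs (diffs m)) w))"
    by (intro sums_add sums_mult powser_Euler_sums termdiff_converges_all sm)
       (simp add: powser_def summable_sums termdiff_converges_all sm)
  have upper: "(\<lambda>k. - b * (3 * \<mu> + 5) * (of_nat k * p k * w ^ k)
            + - b * (\<mu> + 1)\<^sup>2 * (p k * w ^ k)
            + - (2 * b) * (of_nat k * (of_nat k - 1) * p k * w ^ k)) sums
          (- b * (3 * \<mu> + 5) * (w * powser (diffs p) w) + - b * (\<mu> + 1)\<^sup>2 * powser p w
            + - (2 * b) * (w\<^sup>2 * powser (diffs (diffs p)) w))"
    by (intro sums_add sums_mult powser_Euler_sums powser_Euler2_sums sp)
       (simp add: powser_def summable_sums sp)
  have coeff: "(\<mu> + 1) * (diffs m k * w ^ k) + 2 * (of_nat k * diffs m k * w ^ k) =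
          - b * (3 * \<mu> + 5) * (of_nat k * p k * w ^ k)
            + - b * (\<mu> + 1)\<^sup>2 * (p k * w ^ k)
            + - (2 * b) * (of_nat k * (of_nat k - 1) * p k * w ^ k)" for k
  proof -
    have "(\<mu> + 1) * (diffs m k * w ^ k) + 2 * (of_nat k * diffs m k * w ^ k) =
            ((of_nat k + 1) * (\<mu> + 1 + 2 * of_nat k) * m (Suc k)) * w ^ k"
      by (simp add: diffs_def algebra_simps)
    also have "\<dots> = (- b * ((\<mu> + 1 + 2 * of_nat k) * (\<mu> + 1 + of_nat k)) * p k) * w ^ k"
      unfolding m_def p_def clifford_coeff_adjacent ..
    finally show ?thesis by (simp add: algebra_simps power2_eq_square)
  qed
  have "(\<mu> + 1) * powser (diffs m) w + 2 * (w * powser (diffs (diffs m)) w) =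
          - b * (3 * \<mu> + 5) * (w * powser (diffs p) w) + - b * (\<mu> + 1)\<^sup>2 * powser p w
            + - (2 * b) * (w\<^sup>2 * powser (diffs (diffs p)) w)"
    by (rule sums_unique2[OF lower[unfolded coeff] upper])
  thus ?thesis by (simp add: mult.assoc)
qed

section \<open>Derivatives on the slit plane\<close>

text \<open>The second derivative at \<open>z\<close> depends on the first derivative near \<open>z\<close>, so the closed form has
  to hold on an open set.\<close>

lemma deriv_1_2_transform:
  fixes f g :: "complex \<Rightarrow> complex"
  assumes "open S" and "z \<in> S" and eq: "\<And>x. x \<in> S \<Longrightarrow> f x = g x"
    and g: "\<And>x. x \<in> S \<Longrightarrow> (g has_field_derivative g' x) (at x)"
    and g': "(g' has_field_derivative d) (at z)"
  shows "deriv f z = g' z" and "(deriv ^^ 2) f z = d"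
proof -
  have f': "deriv f x = g' x" if "x \<in> S" for x
    using has_field_derivative_transform_within_open[OF g[OF that] assms(1) that] eq
    by (intro DERIV_imp_deriv) auto
  thus "deriv f z = g' z" using assms(2) by blast
  have "(deriv f has_field_derivative d) (at z)"
    using has_field_derivative_transform_within_open[OF g' assms(1,2)] f' by auto
  thus "(deriv ^^ 2) f z = d"
    by (simp add: numeral_2_eq_2 DERIV_imp_deriv)
qed

lemma Bessel_Clifford_derivs:
  fixes b c \<nu> \<rho> z :: complex
  defines "a \<equiv> clifford_coeff b c \<nu> \<rho>"
  assumes "Re \<rho> > 0" and "z \<noteq> 0"
  shows "deriv (Bessel_Clifford b c \<nu> \<rho>) z = powser (diffs a) z"
    and "(deriv ^^ 2) (Bessel_Clifford b c \<nu> \<rho>) z = powser (diffs (diffs a)) z"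
proof -
  have s: "summable (\<lambda>k. a k * w ^ k)" for w
    unfolding a_def by (rule summable_clifford_coeff[OF assms(2)])
  have eq: "Bessel_Clifford b c \<nu> \<rho> x = powser a x" if "x \<in> - {0}" for x
    using that Bessel_Clifford_eq_powser[OF assms(2)] by (simp add: a_def)
  have "open (- {0 :: complex})" "z \<in> - {0}" using assms(3) by auto
  from deriv_1_2_transform[OF this eq powser_has_field_derivative[OF s]
      powser_has_field_derivative[OF termdiff_converges_all[OF s]]]
  show "deriv (Bessel_Clifford b c \<nu> \<rho>) z = powser (diffs a) z"
    and "(deriv ^^ 2) (Bessel_Clifford b c \<nu> \<rho>) z = powser (diffs (diffs a)) z" by auto
qed

text \<open>Multiplied by the matching power of \<open>z\<close>, the derivatives of \<open>(z/2)\<^sup>\<nu> \<Phi>(z\<^sup>2/4)\<close>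
  involve \<open>z\<close> only through \<open>w = z\<^sup>2/4\<close> and the common factor \<open>P\<close>, because \<open>z d/dz\<close> acts
  on the factor \<open>\<Phi>(z\<^sup>2/4)\<close> as \<open>2 w d/dw\<close>.\<close>

lemma spherical_Bessel_derivs:
  fixes b c \<nu> \<rho> z :: complex
  defines "a \<equiv> clifford_coeff b (c - 1/2) (\<nu> + 1/2) \<rho>"
    and "P \<equiv> of_real (sqrt pi / 2) * (z / 2) powr \<nu>" and "w \<equiv> z\<^sup>2 / 4"
  assumes "Re \<rho> > 0" and z: "z \<notin> \<real>\<^sub>\<le>\<^sub>0"
  shows "z * deriv (spherical_Bessel b c \<nu> \<rho>) z
           = P * (\<nu> * powser a w + 2 * w * powser (diffs a) w)"
    and "z\<^sup>2 * (deriv ^^ 2) (spherical_Bessel b c \<nu> \<rho>) z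
           = P * (\<nu> * (\<nu> - 1) * powser a w + (4 * \<nu> + 2) * w * powser (diffs a) w
                  + 4 * w\<^sup>2 * powser (diffs (diffs a)) w)"
proof -
  define K :: complex where "K = of_real (sqrt pi / 2)"
  have s: "summable (\<lambda>k. a k * x ^ k)" for x
    unfolding a_def by (rule summable_clifford_coeff[OF assms(4)])
  note d0 = powser_has_field_derivative[OF s]
  note d1 = powser_has_field_derivative[OF termdiff_converges_all[OF s]]
  define g where "g = (\<lambda>x. K * (x / 2) powr \<nu> * powser a (x\<^sup>2 / 4))"
  define g' where "g' = (\<lambda>x. K * (x / 2) powr \<nu>
      * (\<nu> / x * powser a (x\<^sup>2 / 4) + x / 2 * powser (diffs a) (x\<^sup>2 / 4)))"
  define g'' where "g'' = K * (z / 2) powr \<nu>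
      * (\<nu> * (\<nu> - 1) / z\<^sup>2 * powser a w + (\<nu> + 1/2) * powser (diffs a) w
         + z\<^sup>2 / 4 * powser (diffs (diffs a)) w)"
  have half: "x / 2 \<notin> \<real>\<^sub>\<le>\<^sub>0" and nz: "x \<noteq> 0" if "x \<notin> \<real>\<^sub>\<le>\<^sub>0" for x :: complex
    using that by (auto simp: complex_nonpos_Reals_iff)
  have dp: "((\<lambda>x. (x / 2) powr \<nu>) has_field_derivative \<nu> / x * (x / 2) powr \<nu>) (at x)"
    if "x \<notin> \<real>\<^sub>\<le>\<^sub>0" for x :: complex
  proof -
    have "((\<lambda>x. (x / 2) powr \<nu>) has_field_derivative (\<nu> * (x / 2) powr (\<nu> - 1)) * (1 / 2)) (at x)"
      by (rule DERIV_chain2[where f = "\<lambda>u. u powr \<nu>" and g = "\<lambda>x. x / 2"]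
               has_field_derivative_powr half that)+
         (auto intro!: derivative_eq_intros)
    thus ?thesis using nz[OF that] by (simp add: powr_diff)
  qed
  have dq: "((\<lambda>x. x\<^sup>2 / 4) has_field_derivative x / 2) (at x)" for x :: complex
    by (auto intro!: derivative_eq_intros)
  have da: "((\<lambda>x. powser a (x\<^sup>2 / 4)) has_field_derivative powser (diffs a) (x\<^sup>2 / 4) * (x / 2)) (at x)"
    for x by (rule DERIV_chain2[OF d0 dq])
  have db: "((\<lambda>x. powser (diffs a) (x\<^sup>2 / 4)) has_field_derivative
               powser (diffs (diffs a)) (x\<^sup>2 / 4) * (x / 2)) (at x)"
    for x by (rule DERIV_chain2[OF d1 dq])
  have g: "(g has_field_derivative g' x) (at x)" if "x \<in> - \<real>\<^sub>\<le>\<^sub>0" for x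
  proof -
    from that have x: "x \<notin> \<real>\<^sub>\<le>\<^sub>0" by simp
    show ?thesis
      unfolding g_def g'_def
      by (rule DERIV_cong[OF DERIV_mult[OF DERIV_cmult[OF dp[OF x]] da]])
         (simp add: algebra_simps)
  qed
  have g': "(g' has_field_derivative g'') (at z)"
  proof -
    have di: "((\<lambda>x. \<nu> / x) has_field_derivative - \<nu> / z\<^sup>2) (at z)"
      using nz[OF z] by (auto intro!: derivative_eq_intros simp: power2_eq_square)
    have dh: "((\<lambda>x. x / 2) has_field_derivative 1 / 2) (at z)"
      by (auto intro!: derivative_eq_intros)
    note inner = DERIV_add[OF DERIV_mult[OF di da] DERIV_mult[OF dh db]]
    show ?thesis
      unfolding g'_def g''_def w_def
      by (rule DERIV_cong[OF DERIV_mult[OF DERIV_cmult[OF dp[OF z]] inner]])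
         (use nz[OF z] in \<open>simp add: field_simps power2_eq_square\<close>)
  qed
  have eq: "spherical_Bessel b c \<nu> \<rho> x = g x" if "x \<in> - \<real>\<^sub>\<le>\<^sub>0" for x
    using that spherical_Bessel_eq_powser[OF assms(4)] by (simp add: g_def a_def K_def)
  have S: "open (- \<real>\<^sub>\<le>\<^sub>0 :: complex set)" "z \<in> - \<real>\<^sub>\<le>\<^sub>0" using z by auto
  have deriv1: "deriv (spherical_Bessel b c \<nu> \<rho>) z = g' z"
    and deriv2: "(deriv ^^ 2) (spherical_Bessel b c \<nu> \<rho>) z = g''"
    by (rule deriv_1_2_transform[OF S eq g g'], assumption+)+
  show "z * deriv (spherical_Bessel b c \<nu> \<rho>) z
           = P * (\<nu> * powser a w + 2 * w * powser (diffs a) w)"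
    unfolding deriv1 using nz[OF z]
    by (simp add: g'_def P_def K_def w_def field_simps power2_eq_square)
  show "z\<^sup>2 * (deriv ^^ 2) (spherical_Bessel b c \<nu> \<rho>) z
           = P * (\<nu> * (\<nu> - 1) * powser a w + (4 * \<nu> + 2) * w * powser (diffs a) w
                  + 4 * w\<^sup>2 * powser (diffs (diffs a)) w)"
    unfolding deriv2 using nz[OF z]
    by (simp add: g''_def P_def K_def w_def field_simps power2_eq_square)
qed

text \<open>With \<open>\<theta> = z d/dz\<close>, the operators on \<open>gm\<close> and \<open>gp\<close> are \<open>(\<theta> + 1/2)(\<theta> + 1 - \<nu>)\<close> and
  \<open>b (\<theta> + 1/2)(\<theta> + \<nu> + 2)\<close>. On \<open>z\<^sup>s \<Phi>(z\<^sup>2/4)\<close>, \<open>\<theta>\<close> acts as \<open>s + 2 w d/dw\<close>, and for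
  \<open>s = \<nu> - 1\<close> and \<open>s = \<nu> + 1\<close> they become the two sides of \<open>clifford_powser_adjacent\<close>
  up to sign and the common factor \<open>2 P w\<close>.\<close>

lemma spherical_Bessel_adjacent:
  fixes b c \<nu> \<rho> z :: complex
  defines "gm \<equiv> spherical_Bessel b c (\<nu> - 1) \<rho>" and "gp \<equiv> spherical_Bessel b c (\<nu> + 1) \<rho>"
  assumes "Re \<rho> > 0" and z: "z \<notin> \<real>\<^sub>\<le>\<^sub>0"
  shows "z\<^sup>2 * ((deriv ^^ 2) gm z + b * (deriv ^^ 2) gp z)
           + z * ((5/2 - \<nu>) * deriv gm z + b * (\<nu> + 7/2) * deriv gp z)
         = - ((1 - \<nu>) / 2) * gm z - b * ((2 + \<nu>) / 2) * gp z"
proof -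
  define w where "w = z\<^sup>2 / 4"
  define P where "P = of_real (sqrt pi / 2) * (z / 2) powr (\<nu> - 1)"
  define \<mu> where "\<mu> = \<nu> + 1/2"
  define m where "m = clifford_coeff b (c - 1/2) (\<mu> - 1) \<rho>"
  define p where "p = clifford_coeff b (c - 1/2) (\<mu> + 1) \<rho>"
  have z0: "z \<noteq> 0" using z by auto
  have mu: "\<nu> - 1 + 1/2 = \<mu> - 1" "\<nu> + 1 + 1/2 = \<mu> + 1" by (simp_all add: \<mu>_def)
  \<comment> \<open>The orders differ by two, so the powers of \<open>z/2\<close> in front differ by exactly \<open>w\<close>.\<close>
  have Pp: "of_real (sqrt pi / 2) * (z / 2) powr (\<nu> + 1) = w * P"
  proof -
    have "(z / 2) powr (\<nu> - 1 + of_nat 2) = (z / 2) powr (\<nu> - 1) * (z / 2) ^ 2"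
      using z0 powr_complexpow[of "z / 2" 2]
      by (subst powr_add) (simp del: powr_complexpow of_nat_numeral)
    thus ?thesis by (simp add: P_def w_def power_divide mult_ac add.commute)
  qed
  define F where "F = powser m w"
  define F1 where "F1 = powser (diffs m) w"
  define F2 where "F2 = powser (diffs (diffs m)) w"
  define H where "H = powser p w"
  define H1 where "H1 = powser (diffs p) w"
  define H2 where "H2 = powser (diffs (diffs p)) w"
  have gm: "gm z = P * F"
    and gm1: "z * deriv gm z = P * ((\<nu> - 1) * F + 2 * w * F1)"
    and gm2: "z\<^sup>2 * (deriv ^^ 2) gm z = P * ((\<nu> - 1) * (\<nu> - 1 - 1) * F + (4 * (\<nu> - 1) + 2) * w * F1 + 4 * w\<^sup>2 * F2)"
    using spherical_Bessel_eq_powser[OF assms(3) z, of b c "\<nu> - 1"]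
      spherical_Bessel_derivs[OF assms(3) z, of b c "\<nu> - 1"]
    unfolding mu gm_def P_def w_def m_def F_def F1_def F2_def by - (assumption+)
  have gp: "gp z = w * P * H"
    and gp1: "z * deriv gp z = w * P * ((\<nu> + 1) * H + 2 * w * H1)"
    and gp2: "z\<^sup>2 * (deriv ^^ 2) gp z = w * P * ((\<nu> + 1) * (\<nu> + 1 - 1) * H + (4 * (\<nu> + 1) + 2) * w * H1 + 4 * w\<^sup>2 * H2)"
    using spherical_Bessel_eq_powser[OF assms(3) z, of b c "\<nu> + 1"]
      spherical_Bessel_derivs[OF assms(3) z, of b c "\<nu> + 1"]
    unfolding mu Pp gp_def w_def p_def H_def H1_def H2_def by - (assumption+)
  have ode: "- b * (3 * \<mu> + 5) * w * H1 - b * (\<mu> + 1)\<^sup>2 * H - 2 * b * w\<^sup>2 * H2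
         = (\<mu> + 1) * F1 + 2 * w * F2"
    unfolding F1_def F2_def H_def H1_def H2_def m_def p_def
    by (rule clifford_powser_adjacent[OF assms(3)])
  have "(z\<^sup>2 * ((deriv ^^ 2) gm z + b * (deriv ^^ 2) gp z)
           + z * ((5/2 - \<nu>) * deriv gm z + b * (\<nu> + 7/2) * deriv gp z))
         - (- ((1 - \<nu>) / 2) * gm z - b * ((2 + \<nu>) / 2) * gp z)
       = z\<^sup>2 * (deriv ^^ 2) gm z + b * (z\<^sup>2 * (deriv ^^ 2) gp z)
           + (5/2 - \<nu>) * (z * deriv gm z) + b * (\<nu> + 7/2) * (z * deriv gp z)
         + (1 - \<nu>) / 2 * gm z + b * ((2 + \<nu>) / 2) * gp z"
    by (simp add: algebra_simps)
  also have "\<dots> = 2 * P * w * (((\<mu> + 1) * F1 + 2 * w * F2)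
        - (- b * (3 * \<mu> + 5) * w * H1 - b * (\<mu> + 1)\<^sup>2 * H - 2 * b * w\<^sup>2 * H2))"
    unfolding gm gm1 gm2 gp gp1 gp2 \<mu>_def
    by (simp add: field_simps power2_eq_square)
  also have "\<dots> = 0" unfolding ode by simp
  finally show ?thesis by simp
qed

theorem theorem6p11:
  fixes b \<rho> z :: complex
  assumes "Re \<rho> > 0" and "z \<notin> \<real>\<^sub>\<le>\<^sub>0"
  shows
    "(\<forall>\<nu> c :: complex. Re \<nu> > - 3/2 \<longrightarrow> Re c > 1/2 \<longrightarrow>
        (let gm = spherical_Bessel b (c - 1) (\<nu> - 1) \<rho>;
             gp = spherical_Bessel b (c - 1) (\<nu> + 1) \<rho>
         in z^2 * ((deriv ^^ 2) gm z + b * (deriv ^^ 2) gp z)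
            + z * ((5/2 - \<nu>) * deriv gm z + b * (\<nu> + 7/2) * deriv gp z)
            = - ((1 - \<nu>) / 2) * gm z - b * ((2 + \<nu>) / 2) * gp z))
     \<and>
     (\<forall>\<nu> lam :: complex. Re \<nu> > - 1 \<longrightarrow> Re lam > 0 \<longrightarrow>
        (let Cm = Bessel_Clifford b (lam - 1) (\<nu> - 1) \<rho>;
             Cp = Bessel_Clifford b (lam - 1) (\<nu> + 1) \<rho>
         in - b * (3 * \<nu> + 5) * z * deriv Cp z - b * (\<nu> + 1)^2 * Cp z
              - 2 * b * z^2 * (deriv ^^ 2) Cp z
            = (\<nu> + 1) * deriv Cm z + 2 * z * (deriv ^^ 2) Cm z))"
proof (intro conjI allI impI)
  fix \<nu> c :: complex
  show "let gm = spherical_Bessel b (c - 1) (\<nu> - 1) \<rho>;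
            gp = spherical_Bessel b (c - 1) (\<nu> + 1) \<rho>
        in z^2 * ((deriv ^^ 2) gm z + b * (deriv ^^ 2) gp z)
           + z * ((5/2 - \<nu>) * deriv gm z + b * (\<nu> + 7/2) * deriv gp z)
           = - ((1 - \<nu>) / 2) * gm z - b * ((2 + \<nu>) / 2) * gp z"
    unfolding Let_def by (rule spherical_Bessel_adjacent[OF assms])
next
  fix \<nu> lam :: complex
  have "z \<noteq> 0" using assms(2) by auto
  note C = Bessel_Clifford_derivs[OF assms(1) this] Bessel_Clifford_eq_powser[OF assms(1) this]
  show "let Cm = Bessel_Clifford b (lam - 1) (\<nu> - 1) \<rho>;
            Cp = Bessel_Clifford b (lam - 1) (\<nu> + 1) \<rho>
        in - b * (3 * \<nu> + 5) * z * deriv Cp z - b * (\<nu> + 1)^2 * Cp z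
             - 2 * b * z^2 * (deriv ^^ 2) Cp z
           = (\<nu> + 1) * deriv Cm z + 2 * z * (deriv ^^ 2) Cm z"
    unfolding Let_def C by (rule clifford_powser_adjacent[OF assms(1)])
qed

end
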